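(* Let $\nu\in\mathbb{C}$ with $\Re(\nu)>0$, let $y>0$, and let $g$ be a complex-valued measurable function on $(0,\infty)$ such that the integrals involved in the identity below converge absolutely. Then $$\mathcal{L}_{2}\Big\{u^{2\nu-2}\,\mathcal{L}_{2}\big\{g(x);u\big\};y\Big\}=\frac{\Gamma(\nu)}{2}\,\mathcal{P}_{\nu,2}\big\{g(x);y\big\}.$$
   Context: For a function $f$ on $(0,\infty)$ and $y>0$, the $\mathcal{L}_2$-transform is $$\mathcal{L}_{2}\{f(x);y\}=\int_0^\infty x\,\exp(-x^{2}y^{2})\,f(x)\,dx,$$ and the $\mathcal{P}_{\nu,2}$-transform is $$\mathcal{P}_{\nu,2}\{f(x);y\}=\int_{0}^{\infty}\frac{x\,f(x)}{(x^{2}+y^{2})^{\nu}}\,dx.$$ In the notation $T\{f(x);y\}$, the first entry is the function being transformed (of the indicated dummy variable) and $y$ is the argument of the transform. Absolute convergence of an iterated integral means that it is finite when the fully written-out integrand is replaced by its absolute value. Powers of positive reals with complex exponent are principal. *)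

theory Defs
  imports "HOL-Analysis.Analysis"
begin

definition L2_transform :: "(real \<Rightarrow> complex) \<Rightarrow> real \<Rightarrow> complex" where
  "L2_transform f y =
     (LINT x:{0<..}|lebesgue. complex_of_real (x * exp (- (x\<^sup>2 * y\<^sup>2))) * f x)"

definition P_transform :: "complex \<Rightarrow> (real \<Rightarrow> complex) \<Rightarrow> real \<Rightarrow> complex" where
  "P_transform \<nu> f y =
     (LINT x:{0<..}|lebesgue. complex_of_real x * f x / complex_of_real (x\<^sup>2 + y\<^sup>2) powr \<nu>)"

end

theory Submission imports Defs begin

text \<open>
  Writing out the left-hand side gives an iterated integral in which \<open>u\<close> carries the Gaussian
  weight \<open>exp (- (x\<^sup>2 + y\<^sup>2) * u\<^sup>2)\<close>, the product of the exponentials in the two transforms. Absolute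
  convergence of that iterated integral makes the integrand integrable on the product space (Tonelli), so the
  order of integration may be exchanged (Fubini).
  For fixed \<open>x\<close>, the \<open>u\<close>-integral is then a moment of a Gaussian, which the
  substitution \<open>t = (x\<^sup>2 + y\<^sup>2) * u\<^sup>2\<close> turns into Euler's integral for \<open>Gamma \<nu>\<close>, leaving exactly
  the kernel \<open>(x\<^sup>2 + y\<^sup>2) powr (- \<nu>)\<close> of the \<open>P\<close>-transform
  (lemma \<open>Gaussian_moment_eq_Gamma\<close>).
\<close>

text \<open>
  Fubini's theorem for iterated Lebesgue integrals requires \<open>\<sigma>\<close>-finiteness of the completed measure:
  a countable cover by Borel sets of finite measure serves for the completion too, because
  completing a measure does not change it on those sets.
\<close>
lemma sigma_finite_lebesgue: "sigma_finite_measure (lebesgue :: 'a::euclidean_space measure)"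
proof
  obtain A :: "'a set set" where A: "countable A" "A \<subseteq> sets lborel" "\<Union>A = space lborel"
    "\<forall>a\<in>A. emeasure lborel a \<noteq> \<infinity>"
    using lborel.sigma_finite_countable by blast
  have "A \<subseteq> sets lebesgue"
    using A(2) by auto
  moreover have "\<forall>a\<in>A. emeasure lebesgue a \<noteq> \<infinity>"
    using A(2,4) by (auto simp: emeasure_completion)
  ultimately show "\<exists>A::'a set set. countable A \<and> A \<subseteq> sets lebesgue \<and> \<Union>A = space lebesgue \<and>
      (\<forall>a\<in>A. emeasure lebesgue a \<noteq> \<infinity>)"
    using A(1,3) by (intro exI[of _ A]) auto
qed

lemma complex_of_real_powr_eq_exp:
  "u > 0 \<Longrightarrow> complex_of_real u powr w = exp (w * complex_of_real (ln u))"
  by (simp add: powr_def Ln_of_real)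

lemma borel_measurable_powr_on_positive_reals [measurable]:
  "(\<lambda>u. indicator {0<..} u *\<^sub>R (complex_of_real u powr w)) \<in> borel_measurable borel"
proof -
  have "(\<lambda>u::real. indicator {0<..} u *\<^sub>R exp (w * complex_of_real (ln u))) \<in> borel_measurable borel"
    by measurable
  also have "(\<lambda>u::real. indicator {0<..} u *\<^sub>R exp (w * complex_of_real (ln u))) =
      (\<lambda>u. indicator {0<..} u *\<^sub>R (complex_of_real u powr w))"
    by (auto simp: fun_eq_iff indicator_def complex_of_real_powr_eq_exp)
  finally show ?thesis .
qed

text \<open>
  Substituting \<open>t = c * u\<^sup>2\<close>, a bijection of the positive half-line, in Euler's integral of
  \<open>t powr (\<nu> - 1) / exp t\<close> produces, with the Jacobian \<open>2 * c * u\<close>, the constant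
  \<open>2 * c powr \<nu>\<close> times the integrand below.
\<close>
lemma Gaussian_moment_eq_Gamma:
  fixes \<nu> :: complex and c :: real
  assumes \<nu>: "Re \<nu> > 0" and c: "c > 0"
  shows "(LINT u:{0<..}|lebesgue.
            complex_of_real (u * exp (- (c * u\<^sup>2))) * complex_of_real u powr (2 * \<nu> - 2)) =
         Gamma \<nu> / 2 / complex_of_real c powr \<nu>"
proof -
  define f where "f t = complex_of_real t powr (\<nu> - 1) / complex_of_real (exp t)" for t
  define g where "g u = c * u\<^sup>2" for u :: real
  define k where
    "k u = complex_of_real (u * exp (- (c * u\<^sup>2))) * complex_of_real u powr (2 * \<nu> - 2)" for u
  have image: "g ` {0<..} = {0<..}"
  proof (intro equalityI subsetI)
    fix t :: real assume "t \<in> {0<..}"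
    then have "g (sqrt (t / c)) = t" "sqrt (t / c) \<in> {0<..}"
      using c by (auto simp: g_def)
    then show "t \<in> g ` {0<..}"
      by (metis imageI)
  qed (use c in \<open>auto simp: g_def\<close>)
  have inj: "inj_on g {0<..}"
    using c by (auto simp: inj_on_def g_def)
  have deriv: "(g has_field_derivative 2 * c * u) (at u within {0<..})" for u
    unfolding g_def by (auto intro!: derivative_eq_intros)
  have "(\<lambda>u. \<bar>2 * c * u\<bar> *\<^sub>R f (g u)) absolutely_integrable_on {0<..} \<and>
      integral {0<..} (\<lambda>u. \<bar>2 * c * u\<bar> *\<^sub>R f (g u)) = Gamma \<nu>
      \<longleftrightarrow> f absolutely_integrable_on (g ` {0<..}) \<and> integral (g ` {0<..}) f = Gamma \<nu>"
    by (rule has_absolute_integral_change_of_variables_real) (use inj deriv in auto)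
  moreover have "f absolutely_integrable_on {0<..}" "integral {0<..} f = Gamma \<nu>"
    using absolutely_integrable_Gamma_integral'[OF \<nu>] Gamma_integral_complex'[OF \<nu>]
    by (auto simp: f_def[abs_def] integral_unique)
  ultimately have sub: "(\<lambda>u. \<bar>2 * c * u\<bar> *\<^sub>R f (g u)) absolutely_integrable_on {0<..}"
      "integral {0<..} (\<lambda>u. \<bar>2 * c * u\<bar> *\<^sub>R f (g u)) = Gamma \<nu>"
    using image by auto
  have pullback: "\<bar>2 * c * u\<bar> *\<^sub>R f (g u) = 2 * complex_of_real c powr \<nu> * k u" if "u \<in> {0<..}" for u
  proof -
    have u: "u > 0" using that by simp
    have ln: "ln (c * u\<^sup>2) = ln c + 2 * ln u"
      using c u by (simp add: ln_mult ln_realpow)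
    have "complex_of_real (c * u\<^sup>2) powr (\<nu> - 1) =
        exp (\<nu> * of_real (ln c)) * exp ((2 * \<nu> - 2) * of_real (ln u)) * exp (- of_real (ln c))"
      using c u by (subst complex_of_real_powr_eq_exp)
        (simp_all add: ln exp_add [symmetric] algebra_simps)
    also have "exp (- complex_of_real (ln c)) = 1 / of_real c"
      using c by (simp add: exp_minus exp_of_real inverse_eq_divide flip: of_real_minus)
    finally have powr: "complex_of_real (c * u\<^sup>2) powr (\<nu> - 1) =
        of_real c powr \<nu> * of_real u powr (2 * \<nu> - 2) / of_real c"
      using c u by (simp add: complex_of_real_powr_eq_exp)
    have "\<bar>2 * c * u\<bar> *\<^sub>R f (g u) = of_real (2 * c * u) *
        (complex_of_real (c * u\<^sup>2) powr (\<nu> - 1) / complex_of_real (exp (c * u\<^sup>2)))"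
      using c u by (simp add: f_def g_def scaleR_conv_of_real)
    also have "\<dots> = 2 * complex_of_real c powr \<nu> * k u"
      using c unfolding powr k_def by (simp add: exp_minus field_simps)
    finally show ?thesis .
  qed
  have "Gamma \<nu> = (LINT u:{0<..}|lebesgue. \<bar>2 * c * u\<bar> *\<^sub>R f (g u))"
    using set_lebesgue_integral_eq_integral(2)[OF sub(1)] sub(2) by simp
  also have "\<dots> = (LINT u:{0<..}|lebesgue. 2 * complex_of_real c powr \<nu> * k u)"
    by (rule set_lebesgue_integral_cong) (use pullback in auto)
  also have "\<dots> = 2 * complex_of_real c powr \<nu> * (LINT u:{0<..}|lebesgue. k u)"
    by (rule set_integral_mult_right)
  finally show ?thesis
    using c by (simp add: k_def)
qed

theorem lemma1:
  fixes \<nu> :: complex and y :: real and g :: "real \<Rightarrow> complex"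
  assumes "Re \<nu> > 0" and "y > 0"
    and "g \<in> borel_measurable (lebesgue_on {0<..})"
    and "(\<integral>\<^sup>+u\<in>{0<..}. (\<integral>\<^sup>+x\<in>{0<..}.
            ennreal (cmod (complex_of_real (u * exp (- (u\<^sup>2 * y\<^sup>2))) *
              (complex_of_real u powr (2 * \<nu> - 2) *
                (complex_of_real (x * exp (- (x\<^sup>2 * u\<^sup>2))) * g x)))) \<partial>lebesgue) \<partial>lebesgue) < \<infinity>"
    and "(\<integral>\<^sup>+x\<in>{0<..}.
            ennreal (cmod (complex_of_real x * g x / complex_of_real (x\<^sup>2 + y\<^sup>2) powr \<nu>)) \<partial>lebesgue) < \<infinity>"
  shows "L2_transform (\<lambda>u. complex_of_real u powr (2 * \<nu> - 2) * L2_transform g u) y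
           = Gamma \<nu> / 2 * P_transform \<nu> g y"
proof -
  interpret sigma_finite_measure "lebesgue :: real measure"
    by (rule sigma_finite_lebesgue)
  interpret plane: pair_sigma_finite "lebesgue :: real measure" "lebesgue :: real measure" ..
  \<comment> \<open>Extending both factors by zero to the whole line turns the set integrals into plain integrals,
     to which Fubini's theorem applies; only the exponential in \<open>F\<close> mixes the two variables.\<close>
  define A where "A u = complex_of_real (u * exp (- (u\<^sup>2 * y\<^sup>2))) *
    (indicator {0<..} u *\<^sub>R (complex_of_real u powr (2 * \<nu> - 2)))" for u
  define G where "G x = indicator {0<..} x *\<^sub>R g x" for x :: real
  define F where "F u x = A u * (complex_of_real (x * exp (- (x\<^sup>2 * u\<^sup>2))) * G x)" for u x

  have "A \<in> borel_measurable borel"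
    unfolding A_def by measurable
  then have A_meas [measurable]: "A \<in> borel_measurable lebesgue"
    by (simp add: measurable_completion)
  have G_meas [measurable]: "G \<in> borel_measurable lebesgue"
    using assms(3) unfolding G_def by (subst (asm) borel_measurable_restrict_space_iff) auto
  have id_meas [measurable]: "(\<lambda>x::real. x) \<in> borel_measurable lebesgue"
    by (simp add: measurable_completion)
  have coupling_meas: "(\<lambda>p. complex_of_real (snd p * exp (- ((snd p)\<^sup>2 * (fst p)\<^sup>2))))
      \<in> borel_measurable (lebesgue \<Otimes>\<^sub>M (lebesgue :: real measure))"
  proof -
    let ?P = "(lebesgue :: real measure) \<Otimes>\<^sub>M (lebesgue :: real measure)"
    have [measurable]: "fst \<in> borel_measurable ?P" "snd \<in> borel_measurable ?P"
      using measurable_compose[OF measurable_fst id_meas] measurable_compose[OF measurable_snd id_meas]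
      by auto
    show ?thesis by measurable
  qed
  have F_meas: "case_prod F \<in> borel_measurable (lebesgue \<Otimes>\<^sub>M lebesgue)"
    unfolding F_def case_prod_beta
    by (intro borel_measurable_times coupling_meas measurable_compose[OF measurable_fst A_meas]
        measurable_compose[OF measurable_snd G_meas])

  have "integrable (lebesgue \<Otimes>\<^sub>M lebesgue) (case_prod F)"
  proof (rule integrableI_bounded[OF F_meas])
    have "(\<integral>\<^sup>+p. ennreal (norm (case_prod F p)) \<partial>(lebesgue \<Otimes>\<^sub>M lebesgue)) =
        (\<integral>\<^sup>+u. (\<integral>\<^sup>+x. ennreal (norm (F u x)) \<partial>lebesgue) \<partial>lebesgue)"
      using nn_integral_fst[of "\<lambda>p. ennreal (norm (case_prod F p))"] F_meas by simp
    also have "\<dots> = (\<integral>\<^sup>+u\<in>{0<..}. (\<integral>\<^sup>+x\<in>{0<..}.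
            ennreal (cmod (complex_of_real (u * exp (- (u\<^sup>2 * y\<^sup>2))) *
              (complex_of_real u powr (2 * \<nu> - 2) *
                (complex_of_real (x * exp (- (x\<^sup>2 * u\<^sup>2))) * g x)))) \<partial>lebesgue) \<partial>lebesgue)"
      by (intro nn_integral_cong)
         (auto simp: F_def A_def G_def indicator_def mult.assoc intro!: nn_integral_cong)
    finally show "(\<integral>\<^sup>+p. ennreal (norm (case_prod F p)) \<partial>(lebesgue \<Otimes>\<^sub>M lebesgue)) < \<infinity>"
      using assms(4) by simp
  qed
  then have swap: "(LINT x|lebesgue. (LINT u|lebesgue. F u x)) =
      (LINT u|lebesgue. (LINT x|lebesgue. F u x))"
    by (rule plane.Fubini_integral)

  have inner: "(LINT u|lebesgue. F u x) =
      Gamma \<nu> / 2 * (indicator {0<..} x *\<^sub>R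
        (complex_of_real x * g x / complex_of_real (x\<^sup>2 + y\<^sup>2) powr \<nu>))" for x
  proof -
    have "F u x = complex_of_real x * G x * (indicator {0<..} u *\<^sub>R
        (complex_of_real (u * exp (- ((x\<^sup>2 + y\<^sup>2) * u\<^sup>2))) * complex_of_real u powr (2 * \<nu> - 2)))" for u
    proof -
      have "exp (- ((x\<^sup>2 + y\<^sup>2) * u\<^sup>2)) = exp (- (u\<^sup>2 * y\<^sup>2)) * exp (- (x\<^sup>2 * u\<^sup>2))"
        by (simp add: exp_add [symmetric] algebra_simps)
      then show ?thesis
        by (simp add: F_def A_def)
    qed
    then have "(LINT u|lebesgue. F u x) = complex_of_real x * G x * (LINT u:{0<..}|lebesgue.
        complex_of_real (u * exp (- ((x\<^sup>2 + y\<^sup>2) * u\<^sup>2))) * complex_of_real u powr (2 * \<nu> - 2))"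
      unfolding set_lebesgue_integral_def by (simp only: integral_mult_right_zero)
    also have "\<dots> = complex_of_real x * G x * (Gamma \<nu> / 2 / complex_of_real (x\<^sup>2 + y\<^sup>2) powr \<nu>)"
      using assms(2) by (subst Gaussian_moment_eq_Gamma[OF assms(1)]) (simp_all add: add_nonneg_pos)
    finally show ?thesis
      by (simp add: G_def indicator_def)
  qed

  have "L2_transform (\<lambda>u. complex_of_real u powr (2 * \<nu> - 2) * L2_transform g u) y =
      (LINT u|lebesgue. (LINT x|lebesgue. F u x))"
    unfolding L2_transform_def set_lebesgue_integral_def
  proof (intro Bochner_Integration.integral_cong refl)
    fix u :: real
    have "(LINT x|lebesgue. F u x) =
        A u * (LINT x|lebesgue. complex_of_real (x * exp (- (x\<^sup>2 * u\<^sup>2))) * G x)"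
      unfolding F_def by (rule integral_mult_right_zero)
    then show "indicator {0<..} u *\<^sub>R (complex_of_real (u * exp (- (u\<^sup>2 * y\<^sup>2))) *
        (complex_of_real u powr (2 * \<nu> - 2) *
          (LINT x|lebesgue. indicator {0<..} x *\<^sub>R (complex_of_real (x * exp (- (x\<^sup>2 * u\<^sup>2))) * g x)))) =
        (LINT x|lebesgue. F u x)"
      by (simp add: A_def G_def)
  qed
  also have "\<dots> = (LINT x|lebesgue. Gamma \<nu> / 2 * (indicator {0<..} x *\<^sub>R
        (complex_of_real x * g x / complex_of_real (x\<^sup>2 + y\<^sup>2) powr \<nu>)))"
    unfolding swap [symmetric] inner ..
  also have "\<dots> = Gamma \<nu> / 2 * P_transform \<nu> g y"
    unfolding P_transform_def set_lebesgue_integral_def by (rule integral_mult_right_zero)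
  finally show ?thesis .
qed

end
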